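(* Consider a perfect fluid with energy density $\mu$ and pressure $p$ obeying an equation of state $f(\mu,p)=0$, where $f$ is an analytic function of $(\mu,p)$ at the central values $(\mu_c,p_c)=(\mu(0),p(0))$ and $\partial_\mu f(\mu_c,p_c)\neq 0$. Suppose that $\mu(r)$, $p(r)$ are real analytic at $r=0$ and solve the Tolman--Oppenheimer--Volkoff (TOV) equations together with the equation of state $f(\mu(r),p(r))=0$, for a compact stellar object (i.e. $r>2M(r)$ for $r>0$). Then the pressure $p$ is an even function of the circumferential radius $r$ (its power series about $r=0$ contains only even powers of $r$), and $\mathcal{A}$ is an odd function of $r$ (its power series about $r=0$ contains only odd powers of $r$).
   Context: Units $8\pi G=c=1$, cosmological constant $\Lambda=0$. The TOV equations for functions $\mu(r)$ (energy density) and $p(r)$ (pressure) of the circumferential radius $r$ are $$\frac{dp}{dr}=-\frac{r^{2}(\mu+p)}{2(r-2M)}\left(p+\frac{2M}{r^{3}}\right),\qquad \frac{dM}{dr}=\frac12\mu r^{2},\qquad M(r)=\frac12\int_0^r\mu(x)x^2\,dx .$$ Only regular solutions with $r>2M(r)$ (called stars, or compact stellar objects) are considered. "Real analytic at $r=0$" means given near $r=0$ by a convergent power series in $r$ with real coefficients. The potentials $\phi$ and $\mathcal{A}$ are defined by $$\phi=\frac{2}{r}\sqrt{1-\frac{2M}{r}},\qquad \mathcal{A}\,\phi=p+\frac{2M}{r^{3}},$$ so $\mathcal{A}=\dfrac{r\left(p+2M/r^{3}\right)}{2\sqrt{1-2M/r}}$, which is analytic at $r=0$. *)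

theory Defs
  imports "HOL-Analysis.Analysis"
begin

unbundle fps_syntax

(* A profile is a function of the circumferential radius r >= 0; as a HOL function it has values
   at negative arguments too, but these carry no meaning. Hence the expansion at the centre is
   one-sided (r = 0 included), unlike has_fps_expansion, which constrains both sides. *)
definition has_central_expansion :: "(real \<Rightarrow> real) \<Rightarrow> real fps \<Rightarrow> bool" where
  "has_central_expansion g F \<longleftrightarrow>
     fps_conv_radius F > 0 \<and> (\<forall>\<^sub>F r in nhds 0. 0 \<le> r \<longrightarrow> g r = eval_fps F r)"

definition real_analytic_at_centre :: "(real \<Rightarrow> real) \<Rightarrow> bool" where
  "real_analytic_at_centre g \<longleftrightarrow> (\<exists>F. has_central_expansion g F)"

definition even_at_centre :: "(real \<Rightarrow> real) \<Rightarrow> bool" where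
  "even_at_centre g \<longleftrightarrow> real_analytic_at_centre g \<and>
     (\<forall>F. has_central_expansion g F \<longrightarrow> (\<forall>n. odd n \<longrightarrow> F $ n = 0))"

definition odd_at_centre :: "(real \<Rightarrow> real) \<Rightarrow> bool" where
  "odd_at_centre g \<longleftrightarrow> real_analytic_at_centre g \<and>
     (\<forall>F. has_central_expansion g F \<longrightarrow> (\<forall>n. even n \<longrightarrow> F $ n = 0))"

(* The double series is summed unconditionally (hence absolutely) over all pairs (i, j). *)
definition real_analytic2_at :: "(real \<Rightarrow> real \<Rightarrow> real) \<Rightarrow> real \<Rightarrow> real \<Rightarrow> bool" where
  "real_analytic2_at f x0 y0 \<longleftrightarrow>
     (\<exists>a :: nat \<Rightarrow> nat \<Rightarrow> real. \<exists>\<rho>>0. \<forall>x y. \<bar>x - x0\<bar> < \<rho> \<longrightarrow> \<bar>y - y0\<bar> < \<rho> \<longrightarrow>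
        ((\<lambda>(i, j). a i j * (x - x0) ^ i * (y - y0) ^ j) has_sum f x y) UNIV)"

definition mass :: "(real \<Rightarrow> real) \<Rightarrow> real \<Rightarrow> real" where
  "mass \<mu> r = (1 / 2) * integral {0..r} (\<lambda>x. \<mu> x * x ^ 2)"

(* Units 8 pi G = c = 1, cosmological constant 0. The solution lives on 0 <= r < R, where R may be
   infinite; the equations are singular at r = 0 and are imposed for r > 0. Integrability is
   required because integral is total and returns 0 on non-integrable functions. *)
definition tov_star :: "ereal \<Rightarrow> (real \<Rightarrow> real) \<Rightarrow> (real \<Rightarrow> real) \<Rightarrow> bool" where
  "tov_star R \<mu> p \<longleftrightarrow> 0 < R \<and>
     (\<forall>r>0. ereal r < R \<longrightarrow>
        (\<lambda>x. \<mu> x * x ^ 2) integrable_on {0..r} \<and>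
        r > 2 * mass \<mu> r \<and>
        (mass \<mu> has_real_derivative (1 / 2) * \<mu> r * r ^ 2) (at r) \<and>
        (p has_real_derivative
           - (r ^ 2 * (\<mu> r + p r) / (2 * (r - 2 * mass \<mu> r))) * (p r + 2 * mass \<mu> r / r ^ 3)) (at r))"

definition phi_potential :: "(real \<Rightarrow> real) \<Rightarrow> real \<Rightarrow> real" where
  "phi_potential \<mu> r = (2 / r) * sqrt (1 - 2 * mass \<mu> r / r)"

(* Solves A * phi = p + 2 M / r^3 for A. At r = 0 the HOL convention x / 0 = 0 gives A = 0,
   which is the value of the analytic continuation of A to the centre. *)
definition A_potential :: "(real \<Rightarrow> real) \<Rightarrow> (real \<Rightarrow> real) \<Rightarrow> real \<Rightarrow> real" where
  "A_potential \<mu> p r = (p r + 2 * mass \<mu> r / r ^ 3) / phi_potential \<mu> r"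

lemma A_potential_times_phi:
  assumes "r > 0" "r > 2 * mass \<mu> r"
  shows "A_potential \<mu> p r * phi_potential \<mu> r = p r + 2 * mass \<mu> r / r ^ 3"
  using assms by (simp add: A_potential_def phi_potential_def field_simps)

lemma A_potential_explicit:
  "A_potential \<mu> p r = r * (p r + 2 * mass \<mu> r / r ^ 3) / (2 * sqrt (1 - 2 * mass \<mu> r / r))"
  by (simp add: A_potential_def phi_potential_def)

end

theory Submission
  imports Defs "HOL-Complex_Analysis.Complex_Analysis"
begin

unbundle no vec_syntax

text \<open>
  By strong induction on odd \<open>k\<close> the \<open>k\<close>-th coefficients of \<open>\<mu>\<close> and \<open>p\<close> vanish. If the smaller
  odd coefficients vanish, the pressure equation, whose right-hand side carries a factor \<open>r\<close>,
  forces \<open>p\<^sub>k = 0\<close>. The coefficient of \<open>r\<^sup>k\<close> in \<open>f(\<mu>(r), p(r)) = 0\<close> then reduces to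
  \<open>\<partial>\<^sub>\<mu> f \<cdot> \<mu>\<^sub>k\<close>, because every other monomial of the double series contributes nothing of that
  odd order; so \<open>\<mu>\<^sub>k = 0\<close>. To read off this coefficient it is enough to truncate the double
  series, with a remainder \<open>O(r\<^sup>k\<^sup>+\<^sup>1)\<close>. Finally \<open>\<A>\<close> is \<open>r\<close> times an even function, since
  \<open>(1 - 2M/r)\<^sup>-\<^sup>1\<^sup>/\<^sup>2\<close> is the positive square root of an even function.
\<close>

section \<open>Expansions at the centre\<close>

lemma has_central_expansionI:
  assumes "h has_fps_expansion F" "\<forall>\<^sub>F r in nhds 0. 0 \<le> r \<longrightarrow> g r = h r"
  shows "has_central_expansion g F"
  using assms unfolding has_central_expansion_def has_fps_expansion_def
  by (auto elim: eventually_elim2)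

lemma has_central_expansion_eval:
  assumes "has_central_expansion g F"
  shows "eval_fps F has_fps_expansion F" "\<forall>\<^sub>F r in nhds 0. 0 \<le> r \<longrightarrow> g r = eval_fps F r"
  using assms by (auto simp: has_central_expansion_def intro: eval_fps_has_fps_expansion)

lemma has_central_expansion_at_right:
  assumes "has_central_expansion g F"
  shows "\<forall>\<^sub>F r in at_right 0. g r = eval_fps F r"
  using has_central_expansion_eval(2)[OF assms]
  by (auto simp: eventually_at_filter elim!: eventually_mono)

lemma has_central_expansion_at_0:
  assumes "has_central_expansion g F"
  shows "g 0 = F $ 0"
proof -
  have "\<exists>r. r = (0::real) \<and> (0 \<le> r \<longrightarrow> g r = eval_fps F r)"
    using eventually_nhds_x_imp_x[OF has_central_expansion_eval(2)[OF assms]] by auto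
  thus ?thesis by (auto simp: eval_fps_at_0)
qed

lemma has_fps_expansion_at_0:
  assumes "h has_fps_expansion F"
  shows "h 0 = F $ 0"
  using assms eventually_nhds_x_imp_x[of "\<lambda>z. eval_fps F z = h z" 0]
  by (simp add: has_fps_expansion_def eval_fps_at_0)

lemma has_fps_expansion_power [fps_expansion_intros]:
  fixes F :: "'a :: {banach, real_normed_div_algebra, comm_ring_1} fps"
  assumes "h has_fps_expansion F"
  shows "(\<lambda>x. h x ^ n) has_fps_expansion F ^ n"
  by (induction n) (auto intro!: has_fps_expansion_mult assms)

lemma eventually_at_right_imp_nhds:
  fixes P :: "real \<Rightarrow> bool"
  assumes "\<forall>\<^sub>F r in at_right 0. P r" "P 0"
  shows "\<forall>\<^sub>F r in nhds 0. 0 \<le> r \<longrightarrow> P r"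
proof -
  have "\<forall>\<^sub>F r in nhds 0. r \<noteq> 0 \<longrightarrow> r \<in> {0<..} \<longrightarrow> P r"
    using assms(1) by (simp add: eventually_at_filter)
  thus ?thesis
    by eventually_elim (use assms(2) in \<open>force simp: le_less\<close>)
qed

section \<open>Reading off coefficients from behaviour to the right of the centre\<close>

lemma has_fps_expansion_factor:
  fixes H :: "real fps"
  assumes "h has_fps_expansion H * fps_X ^ d"
  shows "eval_fps H has_fps_expansion H" "\<forall>\<^sub>F r in at_right 0. h r = eval_fps H r * r ^ d"
proof -
  \<comment> \<open>Shifting undoes the multiplication by \<open>fps_X ^ d\<close> and preserves the
    radius of convergence, so the cofactor \<open>H\<close> is itself the series of an analytic
    function.\<close>
  have "fps_conv_radius H = fps_conv_radius (fps_shift d (H * fps_X ^ d))"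
    by (simp only: fps_shift_times_fps_X_power')
  also have "\<dots> = fps_conv_radius (H * fps_X ^ d)" by (rule fps_conv_radius_shift)
  finally show H: "eval_fps H has_fps_expansion H"
    using assms by (auto simp: has_fps_expansion_def)
  have "(\<lambda>x. eval_fps H x * x ^ d) has_fps_expansion H * fps_X ^ d"
    by (intro fps_expansion_intros H)
  with assms have "\<forall>\<^sub>F r in nhds 0. h r = eval_fps H r * r ^ d"
    unfolding has_fps_expansion_def by (auto elim: eventually_elim2)
  thus "\<forall>\<^sub>F r in at_right 0. h r = eval_fps H r * r ^ d"
    using filter_leD[OF at_within_le_nhds] by blast
qed

lemma has_fps_expansion_tendsto_at_right:
  fixes H :: "real fps"
  assumes "h has_fps_expansion H"
  shows "(h \<longlongrightarrow> H $ 0) (at_right 0)"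
  using has_fps_expansion_imp_continuous[OF assms, of "{0<..}"] has_fps_expansion_at_0[OF assms]
  by (simp add: continuous_within)

text \<open>Otherwise the leading exponent \<open>d\<close> is at most \<open>N\<close>. Dividing by
  \<open>r ^ d\<close> leaves a function tending to the nonzero leading coefficient, yet the bound
  squeezes it to 0. A one-sided limit suffices for this contradiction.\<close>

lemma fps_nth_eq_0_of_bound:
  fixes G :: "real fps"
  assumes "h has_fps_expansion G"
    and bound: "\<forall>\<^sub>F r in at_right 0. \<bar>h r\<bar> \<le> C * r ^ Suc N"
    and "n \<le> N"
  shows "G $ n = 0"
proof (rule ccontr)
  assume nz: "G $ n \<noteq> 0"
  define d where "d = subdegree G"
  define H where "H = fps_shift d G"
  have "d \<le> N" using nz \<open>n \<le> N\<close> subdegree_leI[of G n] by (simp add: d_def)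
  have "h has_fps_expansion H * fps_X ^ d"
    using assms(1) by (simp add: H_def d_def fps_shift_times_fps_X_power)
  note H = has_fps_expansion_factor[OF this]
  from bound H(2) eventually_at_right_less[of 0]
  have le: "\<forall>\<^sub>F r in at_right 0. norm (eval_fps H r) \<le> C * r ^ (Suc N - d)"
  proof eventually_elim
    case (elim r)
    have "r ^ Suc N = r ^ (Suc N - d) * r ^ d"
      using \<open>d \<le> N\<close> by (simp flip: power_add)
    with elim have "\<bar>eval_fps H r\<bar> * r ^ d \<le> C * r ^ (Suc N - d) * r ^ d"
      by (simp add: abs_mult)
    with elim show ?case by simp
  qed
  \<comment> \<open>The exponent is at least 1 because \<open>d\<close> is at most \<open>N\<close>,
    so the limit is 0.\<close>
  have "((\<lambda>r. C * r ^ (Suc N - d)) \<longlongrightarrow> C * 0 ^ (Suc N - d)) (at_right (0::real))"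
    by (intro tendsto_intros)
  hence "((\<lambda>r. C * r ^ (Suc N - d)) \<longlongrightarrow> 0) (at_right (0::real))"
    using \<open>d \<le> N\<close> by (simp add: power_0_left)
  from Lim_null_comparison[OF le this] have "H $ 0 = 0"
    using has_fps_expansion_tendsto_at_right[OF H(1)] tendsto_unique[of "at_right (0::real)"]
    by (metis trivial_limit_at_right_real)
  thus False using nz by (auto simp: H_def d_def)
qed

text \<open>Splitting off one power of \<open>r\<close> leaves a factor tending to
  \<open>Q $ 0\<close>, so any constant above its modulus serves as \<open>L\<close>.\<close>

lemma has_fps_expansion_linear_bound:
  fixes H :: "real fps"
  assumes "h has_fps_expansion H" "H $ 0 = 0"
  shows "\<exists>L. \<forall>\<^sub>F r in at_right 0. \<bar>h r\<bar> \<le> L * r"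
proof -
  define Q where "Q = fps_shift 1 H"
  have "H = Q * fps_X ^ 1"
    using assms(2) by (intro fps_ext) (auto simp: Q_def gr0_conv_Suc)
  hence "h has_fps_expansion Q * fps_X ^ 1" using assms(1) by metis
  note Q = has_fps_expansion_factor[OF this]
  have "((\<lambda>r. \<bar>eval_fps Q r\<bar>) \<longlongrightarrow> \<bar>Q $ 0\<bar>) (at_right 0)"
    using has_fps_expansion_tendsto_at_right[OF Q(1)] by (rule tendsto_rabs)
  hence "\<forall>\<^sub>F r in at_right 0. \<bar>eval_fps Q r\<bar> < \<bar>Q $ 0\<bar> + 1"
    by (rule order_tendstoD) simp
  with Q(2) eventually_at_right_less[of 0]
  have "\<forall>\<^sub>F r in at_right 0. \<bar>h r\<bar> \<le> (\<bar>Q $ 0\<bar> + 1) * r"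
    by eventually_elim (auto simp: abs_mult intro!: mult_right_mono)
  thus ?thesis by blast
qed

text \<open>One-sided identity principle: the difference satisfies the preceding bound with
  \<open>C = 0\<close> at every order.\<close>

lemma fps_eq_of_at_right:
  fixes F G :: "real fps"
  assumes "f has_fps_expansion F" "g has_fps_expansion G"
    and "\<forall>\<^sub>F r in at_right 0. f r = g r"
  shows "F = G"
proof (rule fps_ext)
  fix n
  have "(F - G) $ n = 0"
  proof (rule fps_nth_eq_0_of_bound)
    show "(\<lambda>r. f r - g r) has_fps_expansion F - G"
      by (intro fps_expansion_intros assms)
    show "\<forall>\<^sub>F r in at_right 0. \<bar>f r - g r\<bar> \<le> 0 * r ^ Suc n"
      using assms(3) by eventually_elim simp
  qed simp
  thus "F $ n = G $ n" by simp
qed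

lemma has_central_expansion_unique:
  assumes "has_central_expansion g F" "has_central_expansion g G"
  shows "F = G"
  by (rule fps_eq_of_at_right[OF has_central_expansion_eval(1)[OF assms(1)]
        has_central_expansion_eval(1)[OF assms(2)]],
      use has_central_expansion_at_right[OF assms(1)] has_central_expansion_at_right[OF assms(2)]
      in eventually_elim) simp

lemma even_at_centreI:
  assumes "has_central_expansion g F" "\<And>n. odd n \<Longrightarrow> F $ n = 0"
  shows "even_at_centre g"
  using assms has_central_expansion_unique
  unfolding even_at_centre_def real_analytic_at_centre_def by blast

lemma odd_at_centreI:
  assumes "has_central_expansion g F" "\<And>n. even n \<Longrightarrow> F $ n = 0"
  shows "odd_at_centre g"
  using assms has_central_expansion_unique
  unfolding odd_at_centre_def real_analytic_at_centre_def by blast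

section \<open>Analyticity of the inverse square root\<close>

text \<open>The complex extension of the series is holomorphic, so \<open>csqrt\<close> supplies the
  power series; its real part is the wanted one.\<close>

lemma has_fps_expansion_inverse_sqrt:
  fixes h :: "real \<Rightarrow> real"
  assumes "h has_fps_expansion F" "F $ 0 > 0"
  obtains G where "(\<lambda>x. 1 / sqrt (h x)) has_fps_expansion G"
proof -
  define FC where "FC = Abs_fps (\<lambda>n. complex_of_real (F $ n))"
  have rad: "fps_conv_radius FC = fps_conv_radius F"
    unfolding fps_conv_radius_def FC_def
    by (subst (1 2) conv_radius_norm [symmetric]) simp
  have radF: "fps_conv_radius F > 0" using assms(1) by (simp add: has_fps_expansion_def)
  have evalC: "eval_fps FC (of_real x) = of_real (eval_fps F x)" if "ereal \<bar>x\<bar> < fps_conv_radius F" for x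
    using summable_fps[of x F] that
    by (simp add: eval_fps_def FC_def suminf_of_real flip: of_real_power of_real_mult)
  have FC0: "eval_fps FC 0 = of_real (F $ 0)" by (simp add: eval_fps_at_0 FC_def)
  have an: "eval_fps FC analytic_on {0}"
    by (rule analytic_on_eval_fps) (use radF in \<open>auto simp: rad zero_ereal_def\<close>)
  \<comment> \<open>The value at 0 is a positive real, hence off the branch cut of
    \<open>csqrt\<close>.\<close>
  have "(\<lambda>z. 1 / csqrt (eval_fps FC z)) analytic_on {0}"
    by (intro analytic_intros an) (use FC0 assms(2) in \<open>auto simp: complex_nonpos_Reals_iff\<close>)
  then obtain GC where GC: "(\<lambda>z. 1 / csqrt (eval_fps FC z)) has_fps_expansion GC"
    using analytic_at_imp_has_fps_expansion_0 by blast
  define G where "G = Abs_fps (\<lambda>n. Re (GC $ n))"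
  have radGC: "fps_conv_radius GC > 0" using GC by (simp add: has_fps_expansion_def)
  have lim: "filterlim complex_of_real (nhds 0) (nhds 0)"
    using tendsto_of_real[OF filterlim_ident[of "nhds (0::real)"]] by simp
  have ev1: "\<forall>\<^sub>F x in nhds 0. eval_fps GC (of_real x) = 1 / csqrt (eval_fps FC (complex_of_real x))"
    using GC lim by (auto simp: has_fps_expansion_def dest!: filterlim_iff[THEN iffD1, rule_format])
  have ev2: "\<forall>\<^sub>F x::real in nhds 0. x \<in> eball 0 (min (fps_conv_radius F) (fps_conv_radius GC))"
    using radF radGC by (intro eventually_nhds_in_open) (auto simp: zero_ereal_def)
  have ev3: "\<forall>\<^sub>F x in nhds 0. eval_fps F x > 0"
  proof -
    have "isCont (eval_fps F) 0"
      using has_fps_expansion_imp_continuous[OF eval_fps_has_fps_expansion[OF radF]] by simp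
    hence "(eval_fps F \<longlongrightarrow> F $ 0) (nhds 0)"
      using tendsto_at_iff_tendsto_nhds[of "eval_fps F" 0]
      by (simp add: continuous_at eval_fps_at_0)
    thus ?thesis using assms(2) by (rule order_tendstoD)
  qed
  have ev4: "\<forall>\<^sub>F x in nhds 0. eval_fps F x = h x"
    using assms(1) by (simp add: has_fps_expansion_def)
  have "\<forall>\<^sub>F x in nhds 0. (\<lambda>n. G $ n * x ^ n) sums (1 / sqrt (h x))"
    using ev1 ev2 ev3 ev4
  proof eventually_elim
    case (elim x)
    \<comment> \<open>At real \<open>x\<close> near 0 the sum is the real number
      \<open>1 / sqrt (h x)\<close>, so taking real parts termwise keeps it.\<close>
    have "(\<lambda>n. GC $ n * of_real x ^ n) sums eval_fps GC (of_real x)"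
      using elim(2) by (intro sums_eval_fps) auto
    also have "eval_fps GC (of_real x) = of_real (1 / sqrt (h x))"
      using elim by (simp add: evalC)
    finally have "(\<lambda>n. Re (GC $ n * of_real x ^ n)) sums (1 / sqrt (h x))"
      using sums_Re by fastforce
    thus ?case by (simp add: G_def flip: of_real_power)
  qed
  hence "(\<lambda>x. 1 / sqrt (h x)) has_fps_expansion G" by (rule has_fps_expansionI)
  thus ?thesis by (rule that)
qed

section \<open>Parity of coefficients\<close>

text \<open>If two indices add up to an odd \<open>n\<close>, one of them is odd, and both are below
  \<open>k\<close>. The cutoff \<open>k\<close> makes the rule usable inside the strong induction,
  where parity is known only for lower orders.\<close>

lemma fps_mult_odd_coeff_eq_0:
  fixes F G :: "real fps"
  assumes "\<And>n. n < k \<Longrightarrow> odd n \<Longrightarrow> F $ n = 0" "\<And>n. n < k \<Longrightarrow> odd n \<Longrightarrow> G $ n = 0"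
    and "n < k" "odd n"
  shows "(F * G) $ n = 0"
  unfolding fps_mult_nth
proof (intro sum.neutral ballI)
  fix i assume i: "i \<in> {0..n}"
  show "F $ i * G $ (n - i) = 0"
  proof (cases "odd i")
    case True
    then show ?thesis using assms(1)[of i] i \<open>n < k\<close> by simp
  next
    case False
    then show ?thesis using assms(2)[of "n - i"] i \<open>n < k\<close> \<open>odd n\<close> by simp
  qed
qed

lemma fps_power_odd_coeff_eq_0:
  fixes F :: "real fps"
  assumes "\<And>n. n < k \<Longrightarrow> odd n \<Longrightarrow> F $ n = 0" "n < k" "odd n"
  shows "(F ^ m) $ n = 0"
  using assms(2,3)
proof (induction m arbitrary: n)
  case (Suc m)
  show ?case
    unfolding power_Suc by (rule fps_mult_odd_coeff_eq_0[of k]) (use Suc assms(1) in auto)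
qed (auto dest: odd_pos)

text \<open>With zero constant terms the coefficient \<open>k\<close> of a product involves only coefficients
  of index less than \<open>k\<close> of the factors.\<close>

lemma fps_mult_odd_coeff_eq_0':
  fixes F G :: "real fps"
  assumes "\<And>n. n < k \<Longrightarrow> odd n \<Longrightarrow> F $ n = 0" "\<And>n. n < k \<Longrightarrow> odd n \<Longrightarrow> G $ n = 0"
    and "F $ 0 = 0" "G $ 0 = 0" "odd k"
  shows "(F * G) $ k = 0"
  unfolding fps_mult_nth
proof (intro sum.neutral ballI)
  fix i assume i: "i \<in> {0..k}"
  show "F $ i * G $ (k - i) = 0"
  proof (cases "i = 0 \<or> i = k")
    case True
    then show ?thesis using assms(3,4) by auto
  next
    case False
    with assms(1)[of i] assms(2)[of "k - i"] i \<open>odd k\<close> show ?thesis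
      by (cases "odd i") auto
  qed
qed

text \<open>The reflected series \<open>F'\<close> solves the same equation because \<open>S\<close>
  is even. Series over the reals form an integral domain, so \<open>F'\<close> is \<open>F\<close>
  or \<open>- F\<close>; the nonzero constant term excludes the minus sign.\<close>

lemma fps_even_of_square_mult_eq_1:
  fixes F S :: "real fps"
  assumes "F * F * S = 1" "\<And>n. odd n \<Longrightarrow> S $ n = 0" "odd n"
  shows "F $ n = 0"
proof -
  define F' where "F' = F oo - fps_X"
  have "S oo - fps_X = S"
    unfolding fps_compose_uminus' using assms(2) by (intro fps_ext) (auto simp: minus_one_power_iff)
  hence "F' * F' * S = 1"
    using arg_cong[OF assms(1), of "\<lambda>G. G oo - fps_X"]
    by (simp add: fps_compose_mult_distrib F'_def)
  with assms(1) have "F' * F' = F * F"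
    by (metis mult_cancel_right mult_zero_right zero_neq_one)
  hence "F' = F \<or> F' = - F" by (simp add: square_eq_iff)
  moreover have nth: "F' $ n = (-1) ^ n * F $ n" for n
    by (simp add: F'_def fps_compose_uminus')
  moreover have "F $ 0 \<noteq> 0"
    using arg_cong[OF assms(1), of "\<lambda>G. G $ 0"] by auto
  hence "F' \<noteq> - F" using nth[of 0] by (auto dest: arg_cong[of _ _ "\<lambda>G. G $ 0"])
  ultimately have "F' = F" by blast
  with nth[of n] \<open>odd n\<close> show ?thesis by simp
qed

section \<open>The equation of state\<close>

text \<open>Outside the box some index exceeds \<open>N\<close>, so \<open>i + j\<close> is at least
  \<open>Suc N\<close>. Shrinking the radius from \<open>\<sigma>\<close> to \<open>s\<close>
  therefore gains the factor \<open>(s / \<sigma>) ^ Suc N\<close> over the absolutely convergent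
  tail at \<open>\<sigma>\<close>.\<close>

lemma has_sum_box_remainder:
  fixes a :: "nat \<Rightarrow> nat \<Rightarrow> real"
  assumes "\<sigma> > 0" and summable: "(\<lambda>(i, j). a i j * \<sigma> ^ i * \<sigma> ^ j) summable_on UNIV"
  shows "\<exists>K. \<forall>u v s z. \<bar>u\<bar> \<le> s \<longrightarrow> \<bar>v\<bar> \<le> s \<longrightarrow> s \<le> \<sigma> \<longrightarrow>
    ((\<lambda>(i, j). a i j * u ^ i * v ^ j) has_sum z) UNIV \<longrightarrow>
    \<bar>z - (\<Sum>i\<le>N. \<Sum>j\<le>N. a i j * u ^ i * v ^ j)\<bar> \<le> K * s ^ Suc N"
proof -
  define B where "B = {..N} \<times> {..N}"
  define b where "b = (\<lambda>(i, j). \<bar>a i j\<bar> * \<sigma> ^ i * \<sigma> ^ j)"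
  have "b summable_on UNIV"
    using summable_on_iff_abs_summable_on_real[THEN iffD1, OF summable] \<open>\<sigma> > 0\<close>
    by (simp add: b_def abs_mult case_prod_unfold)
  hence bB: "b summable_on - B" using summable_on_subset_banach by blast
  define K where "K = infsum b (- B) / \<sigma> ^ Suc N"
  show ?thesis
  proof (intro exI[of _ K] allI impI)
    fix u v s z
    assume uv: "\<bar>u\<bar> \<le> s" "\<bar>v\<bar> \<le> s" "s \<le> \<sigma>"
      and z: "((\<lambda>(i, j). a i j * u ^ i * v ^ j) has_sum z) UNIV"
    define t where "t = (\<lambda>(i, j). a i j * u ^ i * v ^ j)"
    have "finite B" by (simp add: B_def)
    have "s \<ge> 0" using uv by linarith
    have tB: "(t has_sum (z - sum t B)) (- B)"
      unfolding Compl_eq_Diff_UNIV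
      by (rule has_sum_Diff) (use z \<open>finite B\<close> in \<open>auto simp: t_def\<close>)
    have "sum t B = (\<Sum>i\<le>N. \<Sum>j\<le>N. a i j * u ^ i * v ^ j)"
      by (simp add: B_def t_def sum.cartesian_product)
    moreover have "\<bar>z - sum t B\<bar> \<le> K * s ^ Suc N"
    proof -
      have le: "norm (t x) \<le> b x * (s / \<sigma>) ^ Suc N" if "x \<in> - B" for x
      proof (cases x)
        case (Pair i j)
        have ij: "Suc N \<le> i + j" using that by (auto simp: Pair B_def)
        have "norm (t x) = \<bar>a i j\<bar> * (\<bar>u\<bar> ^ i * \<bar>v\<bar> ^ j)"
          by (simp add: Pair t_def abs_mult power_abs)
        also have "\<dots> \<le> \<bar>a i j\<bar> * (s ^ i * s ^ j)"
          using uv \<open>s \<ge> 0\<close> by (intro mult_left_mono mult_mono power_mono) auto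
        also have "s ^ i * s ^ j = \<sigma> ^ i * \<sigma> ^ j * (s / \<sigma>) ^ (i + j)"
          using \<open>\<sigma> > 0\<close> by (simp add: power_divide power_add)
        also have "\<bar>a i j\<bar> * (\<sigma> ^ i * \<sigma> ^ j * (s / \<sigma>) ^ (i + j))
            \<le> \<bar>a i j\<bar> * (\<sigma> ^ i * \<sigma> ^ j * (s / \<sigma>) ^ Suc N)"
          using uv \<open>s \<ge> 0\<close> \<open>\<sigma> > 0\<close> ij
          by (intro mult_left_mono power_decreasing) auto
        finally show ?thesis by (simp add: Pair b_def mult_ac)
      qed
      have bs: "((\<lambda>x. b x * (s / \<sigma>) ^ Suc N) has_sum infsum b (- B) * (s / \<sigma>) ^ Suc N) (- B)"
        using has_sum_cmult_left[OF has_sum_infsum[OF bB]] .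
      have "(\<lambda>x. norm (t x)) summable_on - B"
        using tB summable_on_iff_abs_summable_on_real[of t "- B"]
        by (auto simp: summable_on_def)
      then obtain c where c: "((\<lambda>x. norm (t x)) has_sum c) (- B)"
        by (auto simp: summable_on_def)
      have "norm (z - sum t B) \<le> c" by (rule norm_has_sum_bound[OF c tB])
      also have "c \<le> infsum b (- B) * (s / \<sigma>) ^ Suc N"
        using has_sum_mono[OF c bs] le by blast
      also have "\<dots> = K * s ^ Suc N" by (simp add: K_def power_divide)
      finally show ?thesis by simp
    qed
    ultimately show "\<bar>z - (\<Sum>i\<le>N. \<Sum>j\<le>N. a i j * u ^ i * v ^ j)\<bar> \<le> K * s ^ Suc N" by simp
  qed
qed

text \<open>Replaces the substitution of two series into a double series by a finite polynomial: the
  full sum vanishes, so the truncation equals minus the remainder, which is of order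
  \<open>r ^ Suc N\<close>.\<close>

lemma analytic_relation_coeff_eq_0:
  fixes a :: "nat \<Rightarrow> nat \<Rightarrow> real"
  assumes "\<rho> > 0"
    and sums: "\<And>x y. \<bar>x\<bar> < \<rho> \<Longrightarrow> \<bar>y\<bar> < \<rho> \<Longrightarrow>
      ((\<lambda>(i, j). a i j * x ^ i * y ^ j) has_sum g x y) UNIV"
    and U: "u has_fps_expansion U" "U $ 0 = 0"
    and V: "v has_fps_expansion V" "V $ 0 = 0"
    and zero: "\<forall>\<^sub>F r in at_right 0. g (u r) (v r) = 0"
    and "n \<le> N"
  shows "(\<Sum>i\<le>N. \<Sum>j\<le>N. fps_const (a i j) * (U ^ i * V ^ j)) $ n = 0"
proof -
  \<comment> \<open>Halving puts the point \<open>(\<sigma>, \<sigma>)\<close> strictly inside the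
    square of convergence.\<close>
  define \<sigma> where "\<sigma> = \<rho> / 2"
  have "\<sigma> > 0" "\<bar>\<sigma>\<bar> < \<rho>" using \<open>\<rho> > 0\<close> by (auto simp: \<sigma>_def)
  have "(\<lambda>(i, j). a i j * \<sigma> ^ i * \<sigma> ^ j) summable_on UNIV"
    using sums[OF \<open>\<bar>\<sigma>\<bar> < \<rho>\<close> \<open>\<bar>\<sigma>\<bar> < \<rho>\<close>] by (auto simp: summable_on_def)
  from has_sum_box_remainder[OF \<open>\<sigma> > 0\<close> this, of N] obtain K where
    K: "\<forall>x y s z. \<bar>x\<bar> \<le> s \<longrightarrow> \<bar>y\<bar> \<le> s \<longrightarrow> s \<le> \<sigma> \<longrightarrow>
      ((\<lambda>(i, j). a i j * x ^ i * y ^ j) has_sum z) UNIV \<longrightarrow>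
      \<bar>z - (\<Sum>i\<le>N. \<Sum>j\<le>N. a i j * x ^ i * y ^ j)\<bar> \<le> K * s ^ Suc N" by (rule exE)
  obtain L1 where L1: "\<forall>\<^sub>F r in at_right 0. \<bar>u r\<bar> \<le> L1 * r"
    using has_fps_expansion_linear_bound[OF U] by blast
  obtain L2 where L2: "\<forall>\<^sub>F r in at_right 0. \<bar>v r\<bar> \<le> L2 * r"
    using has_fps_expansion_linear_bound[OF V] by blast
  \<comment> \<open>One slope for both arguments: the remainder estimate is applied with
    \<open>s = L * r\<close>.\<close>
  define L where "L = max L1 L2"
  have "((\<lambda>r. L * r) \<longlongrightarrow> L * 0) (at_right 0)" by (intro tendsto_intros)
  hence small: "\<forall>\<^sub>F r in at_right 0. L * r < \<sigma>"
    using \<open>\<sigma> > 0\<close> by (intro order_tendstoD) auto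
  define h where "h r = (\<Sum>i\<le>N. \<Sum>j\<le>N. a i j * (u r ^ i * v r ^ j))" for r
  have "h has_fps_expansion (\<Sum>i\<le>N. \<Sum>j\<le>N. fps_const (a i j) * (U ^ i * V ^ j))"
    unfolding h_def by (intro fps_expansion_intros U V)
  moreover have "\<forall>\<^sub>F r in at_right 0. \<bar>h r\<bar> \<le> K * L ^ Suc N * r ^ Suc N"
    using L1 L2 small zero eventually_at_right_less[of 0]
  proof eventually_elim
    case (elim r)
    have "L1 * r \<le> L * r" "L2 * r \<le> L * r"
      using elim by (auto simp: L_def intro!: mult_right_mono)
    hence le: "\<bar>u r\<bar> \<le> L * r" "\<bar>v r\<bar> \<le> L * r" using elim by linarith+
    hence "\<bar>u r\<bar> < \<rho>" "\<bar>v r\<bar> < \<rho>"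
      using elim \<open>\<bar>\<sigma>\<bar> < \<rho>\<close> by linarith+
    from K[rule_format, OF le _ sums[OF this]] show ?case
      using elim by (simp add: h_def power_mult_distrib mult_ac)
  qed
  ultimately show ?thesis using \<open>n \<le> N\<close> by (rule fps_nth_eq_0_of_bound)
qed

text \<open>The condition on \<open>V\<close> reaches index \<open>k\<close> itself, since pure
  powers of \<open>V\<close> must contribute nothing at order \<open>k\<close>. Any other monomial
  except \<open>U\<close> is \<open>U\<close> times a factor with zero constant term, so its
  coefficient at \<open>k\<close> involves only lower ones.\<close>

lemma analytic_relation_odd_coeff:
  fixes a :: "nat \<Rightarrow> nat \<Rightarrow> real"
  assumes "\<rho> > 0"
    and sums: "\<And>x y. \<bar>x\<bar> < \<rho> \<Longrightarrow> \<bar>y\<bar> < \<rho> \<Longrightarrow>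
      ((\<lambda>(i, j). a i j * x ^ i * y ^ j) has_sum g x y) UNIV"
    and U: "u has_fps_expansion U" "U $ 0 = 0"
    and V: "v has_fps_expansion V" "V $ 0 = 0"
    and zero: "\<forall>\<^sub>F r in at_right 0. g (u r) (v r) = 0"
    and "odd k"
    and odd: "\<And>n. n < k \<Longrightarrow> odd n \<Longrightarrow> U $ n = 0" "\<And>n. n < Suc k \<Longrightarrow> odd n \<Longrightarrow> V $ n = 0"
  shows "a 1 0 * U $ k = 0"
proof -
  have coeff: "(U ^ i * V ^ j) $ k = (if i = 1 \<and> j = 0 then U $ k else 0)" for i j
  proof (cases i)
    case 0
    have "(V ^ j) $ k = 0"
      by (rule fps_power_odd_coeff_eq_0[of "Suc k"]) (use odd(2) \<open>odd k\<close> in auto)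
    with 0 show ?thesis by simp
  next
    case (Suc i')
    show ?thesis
    proof (cases "i' = 0 \<and> j = 0")
      case False
      have "(U * (U ^ i' * V ^ j)) $ k = 0"
      proof (rule fps_mult_odd_coeff_eq_0')
        fix n assume n: "n < k" "odd n"
        show "(U ^ i' * V ^ j) $ n = 0"
          by (rule fps_mult_odd_coeff_eq_0[of k]; (rule fps_power_odd_coeff_eq_0[of k])?)
            (use n odd in auto)
      qed (use False U(2) V(2) \<open>odd k\<close> odd in \<open>auto simp: power_0_left fps_power_zeroth\<close>)
      with False Suc show ?thesis by (auto simp: mult.assoc)
    qed (use Suc in simp)
  qed
  have "0 = (\<Sum>i\<le>k. \<Sum>j\<le>k. fps_const (a i j) * (U ^ i * V ^ j)) $ k"
    using analytic_relation_coeff_eq_0[OF assms(1-7) order_refl] by simp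
  also have "\<dots> = (\<Sum>i\<le>k. \<Sum>j\<le>k. if j = 0 then (if i = 1 then a 1 0 * U $ k else 0) else 0)"
    unfolding fps_sum_nth by (intro sum.cong refl) (simp add: coeff)
  also have "\<dots> = a 1 0 * U $ k"
    using odd_pos[OF \<open>odd k\<close>] by simp
  finally show ?thesis by simp
qed

lemma analytic_deriv_eq_coeff:
  fixes a :: "nat \<Rightarrow> nat \<Rightarrow> real"
  assumes "\<rho> > 0"
    and sums: "\<And>x y. \<bar>x\<bar> < \<rho> \<Longrightarrow> \<bar>y\<bar> < \<rho> \<Longrightarrow>
      ((\<lambda>(i, j). a i j * x ^ i * y ^ j) has_sum g x y) UNIV"
  shows "deriv (\<lambda>x. g x 0) 0 = a 1 0"
proof -
  have "(\<lambda>i. a i 0 * x ^ i) sums g x 0" if "\<bar>x\<bar> < \<rho>" for x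
  proof -
    have "((\<lambda>(i, j). a i j * x ^ i * 0 ^ j) has_sum g x 0) UNIV"
      using sums[OF that] \<open>\<rho> > 0\<close> by simp
    \<comment> \<open>Only \<open>j = 0\<close> survives, because \<open>0 ^ j\<close> is 1 there
      and 0 otherwise.\<close>
    also have "?this \<longleftrightarrow> ((\<lambda>(i, j). a i j * x ^ i * 0 ^ j) has_sum g x 0) (range (\<lambda>i. (i, 0)))"
      by (rule has_sum_cong_neutral) (auto simp: image_iff power_0_left)
    also have "\<dots> \<longleftrightarrow> ((\<lambda>i. a i 0 * x ^ i) has_sum g x 0) UNIV"
      by (subst has_sum_reindex) (auto simp: inj_on_def o_def)
    finally show ?thesis by (rule has_sum_imp_sums)
  qed
  moreover have "\<forall>\<^sub>F x in nhds 0. \<bar>x\<bar> < \<rho>"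
    using \<open>\<rho> > 0\<close> by (auto simp: eventually_nhds_metric)
  ultimately have "\<forall>\<^sub>F x in nhds 0. (\<lambda>n. Abs_fps (\<lambda>i. a i 0) $ n * x ^ n) sums g x 0"
    by (auto elim: eventually_mono)
  hence "(\<lambda>x. g x 0) has_fps_expansion Abs_fps (\<lambda>i. a i 0)" by (rule has_fps_expansionI)
  from has_fps_expansion_at_0[OF has_fps_expansion_deriv[OF this]] show ?thesis by simp
qed

section \<open>The field equations\<close>

text \<open>The series of \<open>2 M / r ^ 3\<close>: integrating \<open>U $ n * x ^ (n + 2)\<close>
  from 0 to \<open>r\<close> gives \<open>U $ n * r ^ (n + 3) / (n + 3)\<close>. This is a third of
  the mean density with respect to flat volume.\<close>

definition mean_density_fps :: "real fps \<Rightarrow> real fps" where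
  "mean_density_fps U = Abs_fps (\<lambda>n. U $ n / real (n + 3))"

lemma has_fps_expansion_mean_density:
  assumes "fps_conv_radius U > 0"
  shows "eval_fps (mean_density_fps U) has_fps_expansion mean_density_fps U"
proof -
  have "fps_conv_radius (mean_density_fps U) \<ge> fps_conv_radius U"
    unfolding fps_conv_radius_def
  proof (rule conv_radius_geI_ex')
    fix r :: real assume "0 < r" "ereal r < conv_radius (fps_nth U)"
    hence "summable (\<lambda>n. norm (U $ n * r ^ n))"
      by (intro abs_summable_in_conv_radius) auto
    thus "summable (\<lambda>n. mean_density_fps U $ n * of_real r ^ n)"
      by (rule summable_comparison_test')
        (use \<open>0 < r\<close> in \<open>auto simp: mean_density_fps_def abs_mult divide_simps
          mult_le_cancel_left1 mult_less_0_iff\<close>)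
  qed
  thus ?thesis using assms by (intro eval_fps_has_fps_expansion) auto
qed

lemma mass_eq_mean_density:
  assumes "has_central_expansion \<mu> U"
  shows "\<forall>\<^sub>F r in at_right 0. 2 * mass \<mu> r = r ^ 3 * eval_fps (mean_density_fps U) r"
proof -
  define W where "W = mean_density_fps U"
  define V where "V = fps_X ^ 3 * W"
  have W: "eval_fps W has_fps_expansion W"
    using assms has_fps_expansion_mean_density by (simp add: W_def has_central_expansion_def)
  have V: "(\<lambda>x. x ^ 3 * eval_fps W x) has_fps_expansion V"
    unfolding V_def by (intro fps_expansion_intros W)
  \<comment> \<open>So \<open>V\<close> is the antiderivative of the mass integrand that vanishes at
    0; the factor \<open>n + 1 = m + 3\<close> from differentiation cancels the denominator.\<close>
  have deriv_V: "fps_deriv V = U * fps_X ^ 2"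
  proof (rule fps_ext)
    fix n
    have "fps_deriv V $ n = real (n + 1) * V $ (n + 1)" by simp
    also have "\<dots> = (U * fps_X ^ 2) $ n"
    proof (cases "n < 2")
      case False
      then obtain m where "n = m + 2" by (metis le_add_diff_inverse2 not_less)
      moreover have "real m + 3 \<noteq> 0" by linarith
      ultimately show ?thesis
        by (simp add: V_def W_def mean_density_fps_def fps_X_power_mult_nth
            fps_X_power_mult_right_nth nonzero_divide_eq_eq)
    qed (simp add: V_def fps_X_power_mult_nth fps_X_power_mult_right_nth)
    finally show "fps_deriv V $ n = (U * fps_X ^ 2) $ n" .
  qed
  have U: "eval_fps U has_fps_expansion U" by (rule has_central_expansion_eval[OF assms])
  have UX: "(\<lambda>x. eval_fps U x * x ^ 2) has_fps_expansion U * fps_X ^ 2"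
    by (intro fps_expansion_intros U)
  have "\<forall>\<^sub>F x::real in nhds 0. x \<in> eball 0 (fps_conv_radius V)"
    using V by (intro eventually_nhds_in_open) (auto simp: zero_ereal_def has_fps_expansion_def)
  moreover have "\<forall>\<^sub>F x in nhds 0. eval_fps (U * fps_X ^ 2) x = eval_fps U x * x ^ 2"
    "\<forall>\<^sub>F x in nhds 0. eval_fps V x = x ^ 3 * eval_fps W x"
    using UX V by (simp_all add: has_fps_expansion_def)
  ultimately
  have "\<forall>\<^sub>F x in nhds 0. (0 \<le> x \<longrightarrow> \<mu> x = eval_fps U x) \<and> ereal \<bar>x\<bar> < fps_conv_radius V \<and>
      eval_fps (U * fps_X ^ 2) x = eval_fps U x * x ^ 2 \<and> eval_fps V x = x ^ 3 * eval_fps W x"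
    using has_central_expansion_eval(2)[OF assms] by eventually_elim simp
  then obtain d where "d > 0" and d: "\<And>x. \<bar>x\<bar> < d \<Longrightarrow> 0 \<le> x \<Longrightarrow> \<mu> x = eval_fps U x"
    "\<And>x. \<bar>x\<bar> < d \<Longrightarrow> ereal \<bar>x\<bar> < fps_conv_radius V"
    "\<And>x. \<bar>x\<bar> < d \<Longrightarrow> eval_fps (U * fps_X ^ 2) x = eval_fps U x * x ^ 2"
    "\<And>x. \<bar>x\<bar> < d \<Longrightarrow> eval_fps V x = x ^ 3 * eval_fps W x"
    unfolding eventually_nhds_metric dist_real_def by auto
  have "2 * mass \<mu> r = r ^ 3 * eval_fps W r" if "0 < r" "r < d" for r
  proof -
    have "((\<lambda>x. \<mu> x * x ^ 2) has_integral (eval_fps V r - eval_fps V 0)) {0..r}"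
    proof (rule fundamental_theorem_of_calculus)
      fix x assume x: "x \<in> {0..r}"
      have "(eval_fps V has_field_derivative eval_fps (fps_deriv V) x) (at x within {0..r})"
        using d(2)[of x] x that by (intro has_field_derivative_eval_fps) auto
      also have "eval_fps (fps_deriv V) x = \<mu> x * x ^ 2"
        using d(1,3)[of x] x that by (simp add: deriv_V)
      finally show "(eval_fps V has_vector_derivative \<mu> x * x ^ 2) (at x within {0..r})"
        by (simp add: has_real_derivative_iff_has_vector_derivative)
    qed (use that in simp)
    from integral_unique[OF this] d(4)[of r] d(4)[of 0] that \<open>d > 0\<close> show ?thesis
      by (simp add: mass_def)
  qed
  with \<open>d > 0\<close> show ?thesis unfolding eventually_at_right_field W_def by blast
qed

lemma tov_star_eventually_less:
  assumes "tov_star R \<mu> p"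
  shows "\<forall>\<^sub>F r in at_right 0. ereal r < R"
proof -
  obtain R' where "R' > 0" "ereal R' < R"
    using ereal_dense2[of 0 R] assms by (auto simp: tov_star_def)
  then show ?thesis
    unfolding eventually_at_right_field
    by (intro exI[of _ R']) (auto intro: less_trans[of _ "ereal R'"])
qed

text \<open>With \<open>W\<close> standing for \<open>2 M / r ^ 3\<close>, the quotient
  \<open>2 M / r\<close> is \<open>r ^ 2 * W\<close>. Clearing denominators then leaves only
  analytic terms, so the equation for \<open>r > 0\<close> becomes an identity of series.\<close>

lemma tov_fps_equation:
  assumes \<mu>: "has_central_expansion \<mu> U" and p: "has_central_expansion p P"
    and "tov_star R \<mu> p"
  defines "W \<equiv> mean_density_fps U"
  shows "fps_const 2 * (1 - fps_X ^ 2 * W) * fps_deriv P = - (fps_X * (U + P) * (P + W))"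
proof -
  have U: "eval_fps U has_fps_expansion U" and P: "eval_fps P has_fps_expansion P"
    by (rule has_central_expansion_eval[OF \<mu>] has_central_expansion_eval[OF p])+
  have W: "eval_fps W has_fps_expansion W"
    using \<mu> has_fps_expansion_mean_density by (simp add: W_def has_central_expansion_def)
  have P': "eval_fps (fps_deriv P) has_fps_expansion fps_deriv P"
    using p fps_conv_radius_deriv[of P]
    by (intro eval_fps_has_fps_expansion) (auto simp: has_central_expansion_def)
  have "\<forall>\<^sub>F x::real in nhds 0. x \<in> eball 0 (fps_conv_radius P)"
    using P by (intro eventually_nhds_in_open) (auto simp: zero_ereal_def has_fps_expansion_def)
  with has_central_expansion_eval(2)[OF p]
  have "\<forall>\<^sub>F x in nhds 0. (0 \<le> x \<longrightarrow> p x = eval_fps P x) \<and> ereal \<bar>x\<bar> < fps_conv_radius P"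
    by eventually_elim auto
  then obtain d where "d > 0" and d: "\<And>x. \<bar>x\<bar> < d \<Longrightarrow> 0 \<le> x \<Longrightarrow> p x = eval_fps P x"
    "\<And>x. \<bar>x\<bar> < d \<Longrightarrow> ereal \<bar>x\<bar> < fps_conv_radius P"
    unfolding eventually_nhds_metric dist_real_def by auto
  have "\<forall>\<^sub>F r in at_right 0. r < d"
    using \<open>d > 0\<close> unfolding eventually_at_right_field by blast
  with tov_star_eventually_less[OF \<open>tov_star R \<mu> p\<close>]
    has_central_expansion_at_right[OF \<mu>] mass_eq_mean_density[OF \<mu>]
    eventually_at_right_less[of 0]
  have "\<forall>\<^sub>F r in at_right 0. 2 * (1 - r ^ 2 * eval_fps W r) * eval_fps (fps_deriv P) r =
      - (r * (eval_fps U r + eval_fps P r) * (eval_fps P r + eval_fps W r))"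
  proof eventually_elim
    case (elim r)
    define w where "w = eval_fps W r"
    have m: "2 * mass \<mu> r = r ^ 3 * w" using elim by (simp add: w_def W_def)
    have star: "r > 2 * mass \<mu> r"
      and p': "(p has_real_derivative - (r ^ 2 * (\<mu> r + p r) / (2 * (r - 2 * mass \<mu> r))) *
        (p r + 2 * mass \<mu> r / r ^ 3)) (at r)"
      using \<open>tov_star R \<mu> p\<close> elim unfolding tov_star_def by blast+
    \<comment> \<open>The profile matches its series only on the nonnegative side; since
      \<open>r > 0\<close>, a full neighbourhood of \<open>r\<close> lies there and the two-sided
      derivatives agree.\<close>
    have "\<forall>\<^sub>F x in nhds r. x \<in> {0<..<d}"
      using elim by (intro eventually_nhds_in_open) auto
    hence "\<forall>\<^sub>F x in nhds r. p x = eval_fps P x"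
      by eventually_elim (auto intro: d)
    moreover have "(eval_fps P has_real_derivative eval_fps (fps_deriv P) r) (at r)"
      using d(2)[of r] elim by (intro has_field_derivative_eval_fps) auto
    ultimately have "(p has_real_derivative eval_fps (fps_deriv P) r) (at r)"
      by (subst DERIV_cong_ev) auto
    from DERIV_unique[OF this p'] have "eval_fps (fps_deriv P) r =
        - (r ^ 2 * (\<mu> r + p r) / (2 * (r - r ^ 3 * w))) * (p r + w)"
      using elim by (simp add: m)
    also have "r - r ^ 3 * w = r * (1 - r ^ 2 * w)"
      by (simp add: algebra_simps eval_nat_numeral)
    finally have eq: "eval_fps (fps_deriv P) r =
        - (r ^ 2 * (\<mu> r + p r) / (2 * (r * (1 - r ^ 2 * w)))) * (p r + w)" .
    \<comment> \<open>The compactness condition \<open>r > 2 M\<close> keeps the denominator away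
      from zero.\<close>
    have "r * (1 - r ^ 2 * w) > 0" using star m by (simp add: algebra_simps eval_nat_numeral)
    hence "1 - r ^ 2 * w \<noteq> 0" by auto
    hence "2 * (1 - r ^ 2 * w) * eval_fps (fps_deriv P) r = - (r * (\<mu> r + p r) * (p r + w))"
      using elim unfolding eq by (simp add: divide_simps) (simp add: algebra_simps eval_nat_numeral)
    moreover have "p r = eval_fps P r" using elim by (intro d) auto
    ultimately show ?case using elim by (simp add: w_def)
  qed
  moreover have "(\<lambda>r. 2 * (1 - r ^ 2 * eval_fps W r) * eval_fps (fps_deriv P) r) has_fps_expansion
      fps_const 2 * (1 - fps_X ^ 2 * W) * fps_deriv P"
    by (intro fps_expansion_intros W P')
  moreover have "(\<lambda>r. - (r * (eval_fps U r + eval_fps P r) * (eval_fps P r + eval_fps W r)))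
      has_fps_expansion - (fps_X * (U + P) * (P + W))"
    by (intro fps_expansion_intros U P W)
  ultimately show ?thesis by (blast intro: fps_eq_of_at_right)
qed

text \<open>Multiplied by the variable, the equation isolates \<open>2 * Q\<close>, whose
  coefficient at \<open>k\<close> is \<open>2 * k * P $ k\<close>. All other terms carry
  \<open>fps_X ^ 2\<close> and thus depend only on orders up to \<open>k - 2\<close>.\<close>

lemma tov_odd_coeff:
  fixes U P W :: "real fps"
  assumes eq: "fps_const 2 * (1 - fps_X ^ 2 * W) * fps_deriv P = - (fps_X * (U + P) * (P + W))"
    and odd: "\<And>n. n < k \<Longrightarrow> odd n \<Longrightarrow> U $ n = 0" "\<And>n. n < k \<Longrightarrow> odd n \<Longrightarrow> P $ n = 0"
      "\<And>n. n < k \<Longrightarrow> odd n \<Longrightarrow> W $ n = 0"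
    and "odd k"
  shows "P $ k = 0"
proof -
  \<comment> \<open>Differentiation flips parity; multiplying by the variable restores it.\<close>
  define Q where "Q = fps_X * fps_deriv P"
  have Q: "Q $ n = real n * P $ n" for n
    by (cases n) (simp_all add: Q_def)
  have "fps_const 2 * Q = fps_X * (fps_const 2 * (1 - fps_X ^ 2 * W) * fps_deriv P)
      + fps_const 2 * (fps_X ^ 2 * (W * Q))"
    by (simp add: Q_def algebra_simps)
  also have "\<dots> = fps_const 2 * (fps_X ^ 2 * (W * Q)) - fps_X ^ 2 * ((U + P) * (P + W))"
    unfolding eq by (simp add: algebra_simps power2_eq_square)
  finally have "2 * (real k * P $ k) =
      (fps_const 2 * (fps_X ^ 2 * (W * Q)) - fps_X ^ 2 * ((U + P) * (P + W))) $ k"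
    by (metis Q fps_mult_left_const_nth)
  also have "\<dots> = 0"
  \<comment> \<open>For \<open>k = 1\<close> the factor \<open>fps_X ^ 2\<close> already kills the
    coefficient; natural subtraction makes \<open>k - 2\<close> meaningful only in the other
    case.\<close>
  proof (cases "k < 2")
    case False
    have "(W * Q) $ (k - 2) = 0"
      by (rule fps_mult_odd_coeff_eq_0[of k]) (use odd Q \<open>odd k\<close> False in auto)
    moreover have "((U + P) * (P + W)) $ (k - 2) = 0"
      by (rule fps_mult_odd_coeff_eq_0[of k]) (use odd \<open>odd k\<close> False in auto)
    ultimately show ?thesis using False by (simp add: fps_X_power_mult_nth)
  qed (simp add: fps_X_power_mult_nth)
  finally show ?thesis using odd_pos[OF \<open>odd k\<close>] by simp
qed

section \<open>Oddness of the potential\<close>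

lemma A_potential_odd_at_centre:
  assumes \<mu>: "has_central_expansion \<mu> U" and p: "has_central_expansion p P"
    and odd: "\<And>n. odd n \<Longrightarrow> U $ n = 0" "\<And>n. odd n \<Longrightarrow> P $ n = 0"
  shows "odd_at_centre (A_potential \<mu> p)"
proof -
  define W where "W = mean_density_fps U"
  define S where "S = 1 - fps_X ^ 2 * W"
  have P: "eval_fps P has_fps_expansion P" by (rule has_central_expansion_eval[OF p])
  have W: "eval_fps W has_fps_expansion W"
    using \<mu> has_fps_expansion_mean_density by (simp add: W_def has_central_expansion_def)
  define s where "s r = 1 - r ^ 2 * eval_fps W r" for r
  have s: "s has_fps_expansion S"
    unfolding s_def S_def by (intro fps_expansion_intros W)
  have "S $ 0 > 0" by (simp add: S_def fps_X_power_mult_nth)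
  from has_fps_expansion_inverse_sqrt[OF s this] obtain G
    where G: "(\<lambda>r. 1 / sqrt (s r)) has_fps_expansion G" .
  have odd_W: "W $ n = 0" if "odd n" for n
    using odd(1)[OF that] by (simp add: W_def mean_density_fps_def)
  have odd_S: "S $ n = 0" if "odd n" for n
    using odd_W that odd_pos[OF that] by (simp add: S_def fps_X_power_mult_nth)
  have GGS: "G * G * S = 1"
  proof (rule fps_eq_of_at_right)
    show "(\<lambda>r. 1 / sqrt (s r) * (1 / sqrt (s r)) * s r) has_fps_expansion G * G * S"
      by (intro fps_expansion_intros G s)
    have "\<forall>\<^sub>F r in at_right 0. s r > 0"
      using has_fps_expansion_tendsto_at_right[OF s] \<open>S $ 0 > 0\<close> by (rule order_tendstoD)
    thus "\<forall>\<^sub>F r in at_right 0. 1 / sqrt (s r) * (1 / sqrt (s r)) * s r = 1"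
      by eventually_elim simp
  qed (rule has_fps_expansion_1)
  have odd_G: "G $ n = 0" if "odd n" for n
    using fps_even_of_square_mult_eq_1[OF GGS odd_S that] .
  \<comment> \<open>The three series \<open>P\<close>, \<open>W\<close>, \<open>G\<close> are even;
    the single factor \<open>fps_X\<close> makes \<open>H\<close> odd.\<close>
  define H where "H = fps_const (1 / 2) * (fps_X * ((P + W) * G))"
  have "H $ n = 0" if "even n" for n
  proof (cases n)
    case (Suc m)
    have "((P + W) * G) $ m = 0"
      by (rule fps_mult_odd_coeff_eq_0[of "Suc m"]) (use odd odd_W odd_G Suc that in auto)
    with Suc show ?thesis by (simp add: H_def)
  qed (simp add: H_def)
  moreover have "has_central_expansion (A_potential \<mu> p) H"
  proof (rule has_central_expansionI)
    show "(\<lambda>r. 1 / 2 * (r * ((eval_fps P r + eval_fps W r) * (1 / sqrt (s r))))) has_fps_expansion H"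
      unfolding H_def by (intro fps_expansion_intros P W G)
    have "\<forall>\<^sub>F r in at_right 0. A_potential \<mu> p r =
        1 / 2 * (r * ((eval_fps P r + eval_fps W r) * (1 / sqrt (s r))))"
      using has_central_expansion_at_right[OF p] mass_eq_mean_density[OF \<mu>]
        eventually_at_right_less[of 0]
    proof eventually_elim
      case (elim r)
      hence "2 * mass \<mu> r / r ^ 3 = eval_fps W r" "1 - 2 * mass \<mu> r / r = s r"
        by (auto simp: W_def s_def eval_nat_numeral)
      with elim show ?case by (simp add: A_potential_explicit)
    qed
    \<comment> \<open>At \<open>r = 0\<close> both sides vanish because of the factor
      \<open>r\<close>.\<close>
    thus "\<forall>\<^sub>F r in nhds 0. 0 \<le> r \<longrightarrow> A_potential \<mu> p r =
        1 / 2 * (r * ((eval_fps P r + eval_fps W r) * (1 / sqrt (s r))))"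
      by (rule eventually_at_right_imp_nhds) (simp add: A_potential_explicit)
  qed
  ultimately show ?thesis by (blast intro: odd_at_centreI)
qed

section \<open>Induction on the odd order and conclusion\<close>

theorem corollary1:
  fixes f :: "real \<Rightarrow> real \<Rightarrow> real" and \<mu> p :: "real \<Rightarrow> real" and R :: ereal
  assumes "real_analytic2_at f (\<mu> 0) (p 0)"
    and "deriv (\<lambda>m. f m (p 0)) (\<mu> 0) \<noteq> 0"
    and "real_analytic_at_centre \<mu>"
    and "real_analytic_at_centre p"
    and "tov_star R \<mu> p"
    and "\<forall>r\<ge>0. ereal r < R \<longrightarrow> f (\<mu> r) (p r) = 0"
  shows "even_at_centre p \<and> odd_at_centre (A_potential \<mu> p)"
proof -
  obtain U where \<mu>: "has_central_expansion \<mu> U"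
    using assms(3) by (auto simp: real_analytic_at_centre_def)
  obtain P where p: "has_central_expansion p P"
    using assms(4) by (auto simp: real_analytic_at_centre_def)
  have U0: "U $ 0 = \<mu> 0" and P0: "P $ 0 = p 0"
    using has_central_expansion_at_0 \<mu> p by simp_all
  \<comment> \<open>Centring makes the constant terms zero, as the truncation argument requires, and
    leaves all odd coefficients unchanged.\<close>
  define u where "u r = eval_fps U r - \<mu> 0" for r
  define v where "v r = eval_fps P r - p 0" for r
  define U' where "U' = U - fps_const (\<mu> 0)"
  define P' where "P' = P - fps_const (p 0)"
  have u: "u has_fps_expansion U'" "U' $ 0 = 0"
    unfolding u_def U'_def
    by (intro fps_expansion_intros has_central_expansion_eval(1)[OF \<mu>]) (simp add: U0)
  have v: "v has_fps_expansion P'" "P' $ 0 = 0"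
    unfolding v_def P'_def
    by (intro fps_expansion_intros has_central_expansion_eval(1)[OF p]) (simp add: P0)
  obtain a \<rho> where "\<rho> > 0" and f: "\<forall>x y. \<bar>x - \<mu> 0\<bar> < \<rho> \<longrightarrow> \<bar>y - p 0\<bar> < \<rho> \<longrightarrow>
      ((\<lambda>(i, j). a i j * (x - \<mu> 0) ^ i * (y - p 0) ^ j) has_sum f x y) UNIV"
    using assms(1) unfolding real_analytic2_at_def by (elim exE conjE)
  define g where "g x y = f (\<mu> 0 + x) (p 0 + y)" for x y
  have sums: "((\<lambda>(i, j). a i j * x ^ i * y ^ j) has_sum g x y) UNIV"
    if "\<bar>x\<bar> < \<rho>" "\<bar>y\<bar> < \<rho>" for x y
    using f[rule_format, of "\<mu> 0 + x" "p 0 + y"] that by (simp add: g_def)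
  have "deriv (\<lambda>m. f m (p 0)) (\<mu> 0) = a 1 0"
    using analytic_deriv_eq_coeff[OF \<open>\<rho> > 0\<close> sums]
    by (subst deriv_shift_0) (simp add: g_def o_def)
  hence a10: "a 1 0 \<noteq> 0" using assms(2) by simp
  from tov_star_eventually_less[OF assms(5)] has_central_expansion_at_right[OF \<mu>]
    has_central_expansion_at_right[OF p] eventually_at_right_less[of 0]
  have zero: "\<forall>\<^sub>F r in at_right 0. g (u r) (v r) = 0"
  proof eventually_elim
    case (elim r)
    have "f (\<mu> r) (p r) = 0" using assms(6)[rule_format, of r] elim(1,4) by simp
    with elim(2,3) show ?case by (simp add: g_def u_def v_def)
  qed
  note eq = tov_fps_equation[OF \<mu> p assms(5)]
  have odd: "U $ k = 0 \<and> P $ k = 0" if "odd k" for k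
    using that
  proof (induction k rule: less_induct)
    case (less k)
    have Pk: "P $ k = 0"
      by (rule tov_odd_coeff[OF eq, of k]) (use less in \<open>auto simp: mean_density_fps_def\<close>)
    have "a 1 0 * U' $ k = 0"
    proof (rule analytic_relation_odd_coeff[OF \<open>\<rho> > 0\<close> sums u v zero \<open>odd k\<close>])
      fix n :: nat assume n: "odd n"
      show "U' $ n = 0" if "n < k"
        using less.IH[OF that n] odd_pos[OF n] by (simp add: U'_def)
      \<comment> \<open>The case \<open>n = k\<close> is the pressure coefficient just obtained;
        smaller indices come from the induction hypothesis.\<close>
      show "P' $ n = 0" if "n < Suc k"
        using less.IH[OF _ n] that Pk odd_pos[OF n] by (cases "n = k") (auto simp: P'_def)
    qed
    with a10 Pk odd_pos[OF less.prems] show ?case by (simp add: U'_def)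
  qed
  have "even_at_centre p" using odd by (auto intro: even_at_centreI[OF p])
  moreover have "odd_at_centre (A_potential \<mu> p)"
    using odd by (auto intro: A_potential_odd_at_centre[OF \<mu> p])
  ultimately show ?thesis by blast
qed

end
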